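(* Let $\theta>0$ be real and let $R(w_0,z_0,z_1,z_2)$ be the stability function (defined in the context) of the first adaptation of the Modified Craig--Sneyd scheme. (a) If $\theta\ge\frac13$, then $|R(w_0,z_0,z_1,z_2)|\le 1$ for all $w_0,z_0,z_1,z_2\in\mathbb{R}$ satisfying $$|z_0|+|w_0|\le 2\sqrt{\operatorname{Re} z_1\,\operatorname{Re} z_2}\quad\text{and}\quad \operatorname{Re} z_1\le-\tfrac12|w_0|,\ \operatorname{Re} z_2\le-\tfrac12|w_0|. \qquad ( * )$$ (b) If $\frac12\le\theta\le 1$, then $|R(w_0,z_0,z_1,z_2)|\le 1$ for all $w_0,z_0,z_1,z_2\in\mathbb{C}$ satisfying $( * )$.
   Context: $\operatorname{Re}$ denotes the real part. For a real parameter $\theta>0$ and complex numbers $w_0,z_0,z_1,z_2$, put $$z=w_0+z_0+z_1+z_2,\qquad p=(1-\theta z_1)(1-\theta z_2),$$ $$R(w_0,z_0,z_1,z_2)=1+\frac{z}{p}+\theta\,\frac{(w_0+z_0)z}{p^2}+\left(\tfrac12-\theta\right)\frac{z^2}{p^2}.$$ This is the function such that the first adaptation of the Modified Craig--Sneyd scheme with parameter $\theta$ (integral term and mixed derivative term treated jointly explicitly), applied to the scalar test equation $\dot U=(\lambda_0+\mu_0+\mu_1+\mu_2)U$ with step size $\Delta t$, gives $U_n=R(w_0,z_0,z_1,z_2)U_{n-1}$, where $w_0=\lambda_0\Delta t$ and $z_j=\mu_j\Delta t$ for $j=0,1,2$. *)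

theory Defs
  imports Complex_Main
begin

text \<open>
  Stability function of the first adaptation of the Modified Craig--Sneyd scheme with parameter
  \<open>\<theta>\<close> (integral term and mixed derivative term jointly explicit) for the scalar test equation
  \<open>U' = (\<lambda>\<^sub>0 + \<mu>\<^sub>0 + \<mu>\<^sub>1 + \<mu>\<^sub>2) U\<close>, where \<open>w0 = \<lambda>\<^sub>0 \<Delta>t\<close> and \<open>zj = \<mu>\<^sub>j \<Delta>t\<close>: one step reads
  \<open>U\<^sub>n = mcs_R \<theta> w0 z0 z1 z2 * U\<^sub>n\<^sub>-\<^sub>1\<close>.
  For \<open>\<theta> > 0\<close> and \<open>Re z1, Re z2 \<le> 0\<close> the denominator \<open>mcs_p \<theta> z1 z2\<close> is nonzero.
\<close>

definition mcs_p :: "real \<Rightarrow> complex \<Rightarrow> complex \<Rightarrow> complex" where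
  "mcs_p \<theta> z1 z2 = (1 - of_real \<theta> * z1) * (1 - of_real \<theta> * z2)"

definition mcs_R :: "real \<Rightarrow> complex \<Rightarrow> complex \<Rightarrow> complex \<Rightarrow> complex \<Rightarrow> complex" where
  "mcs_R \<theta> w0 z0 z1 z2 =
     (let z = w0 + z0 + z1 + z2; p = mcs_p \<theta> z1 z2
      in 1 + z / p + of_real \<theta> * ((w0 + z0) * z / p ^ 2) + (1 / 2 - of_real \<theta>) * (z ^ 2 / p ^ 2))"

text \<open>The two sign conditions make the radicand nonnegative.\<close>

definition stab_cond :: "complex \<Rightarrow> complex \<Rightarrow> complex \<Rightarrow> complex \<Rightarrow> bool" where
  "stab_cond w0 z0 z1 z2 \<longleftrightarrow>
     cmod z0 + cmod w0 \<le> 2 * sqrt (Re z1 * Re z2) \<and>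
     Re z1 \<le> - (1 / 2) * cmod w0 \<and> Re z2 \<le> - (1 / 2) * cmod w0"

end

theory Submission imports Defs begin

text \<open>
  Only \<open>u = w\<^sub>0 + z\<^sub>0\<close> matters, with \<open>\<bar>u\<bar> \<le> 2 sqrt (Re z\<^sub>1 Re z\<^sub>2)\<close>.

  For real arguments put \<open>s = - (z\<^sub>1 + z\<^sub>2)\<close>. Then \<open>p\<^sup>2 (R + 1) = 2 p\<^sup>2 + (p + \<theta> s) z + z\<^sup>2 / 2\<close>
  has nonpositive discriminant in \<open>z\<close> because \<open>\<theta> s \<le> p\<close>, and \<open>R \<le> 1\<close> reduces to
  \<open>1 + (4 \<theta> - 2) y + \<theta>\<^sup>2 y\<^sup>2 \<ge> 0\<close> with \<open>y = sqrt (z\<^sub>1 z\<^sub>2)\<close>, which is where \<open>\<theta> \<ge> 1 / 3\<close> enters.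

  For complex arguments put \<open>\<beta> = (1 + \<theta> z\<^sub>1) (1 + \<theta> z\<^sub>2) / p\<close>, \<open>\<gamma> = 1 + 2 \<theta> z / p\<close> and
  \<open>\<kappa> = 1 / (2 \<theta>)\<close>. Then \<open>R = 1 + \<kappa> (3 - \<beta>) (\<gamma> - 1) / 2 + \<kappa>\<^sup>2 (\<gamma> - 1)\<^sup>2 / 2\<close>, and the hypothesis
  becomes \<open>\<bar>\<beta>\<bar> + \<bar>\<gamma> - \<beta>\<bar> \<le> 1\<close> by the Cauchy--Schwarz inequality. With \<open>m = 3 - 2 \<kappa>\<close>, the value
  \<open>8 m R\<close> splits as \<open>K + (3 - m) (M \<beta> - L (\<gamma> - \<beta>))\<close> with polynomials \<open>K, M, L\<close> in \<open>\<gamma>\<close> such that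
  \<open>\<bar>L\<bar> \<le> \<bar>M\<bar>\<close> and \<open>\<bar>K\<bar> + (3 - m) \<bar>M\<bar> \<le> 8 m\<close> on the unit disc.
\<close>

section \<open>The inequality on the unit disc\<close>

text \<open>With \<open>g = X + i Y\<close>, the left side is
  \<open>16 m w - |K|^2 - n w |M|^2\<close> for the two complex terms \<open>K\<close>,
  \<open>M\<close> of the next lemma. The right side is a certificate of nonnegativity for
  \<open>1 \<le> m \<le> 3\<close> and \<open>|g| \<le> 1\<close>: \<open>d = |1 - g|^2\<close>, and
  everything vanishes at \<open>g = 1\<close>.\<close>

lemma mcs_split_real_identity:
  fixes m X Y :: real
  defines "a \<equiv> m * (m^2 - 1)" and "b \<equiv> (3 - m) * (2*m - 1) * (m + 1)"
    and "c \<equiv> (3 - m) * (m - 1)^2" and "d \<equiv> (1 - X)^2 + Y^2" and "w \<equiv> 5 * m - 3" and "n \<equiv> 3 - m"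
  shows "16 * m * w - ((a + b * X - c * (X^2 - Y^2))^2 + (b * Y - c * (2 * X * Y))^2)
       - n * w * ((1 + m - (m - 1) * X)^2 + ((m - 1) * Y)^2)
     = a * c * d^2 + (1 - (X^2 + Y^2)) *
         (c * (a + c) * d + w * n * (8*m - 4) + 4 * c * w * (1 - X))"
proof -
  \<comment> \<open>This is the value \<open>2 w\<close> of \<open>K\<close> at
    \<open>g = 1\<close>. The next three facts treat the coefficients of \<open>1\<close>,
    \<open>2 X\<close> and \<open>X^2 + Y^2\<close>.\<close>
  have b: "b = 2 * w - a + c"
    unfolding a_def b_def c_def w_def by (simp add: power2_eq_square algebra_simps)
  have 1: "16 * m * w - a^2 - n * w * (1+m)^2 = a*c + c*(a+c) + w * n * (8*m - 4) + 4 * c * w"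
    unfolding a_def c_def w_def n_def by (simp add: power2_eq_square algebra_simps)
  have 2: "- a * b + n*w*(m^2-1) = - 2 * a * c - c*(a+c) - 2*c*w"
    unfolding a_def b_def c_def w_def n_def by (simp add: power2_eq_square algebra_simps)
  have 3: "- (b^2) - n*w*(m-1)^2 = 4*a*c - w * n * (8*m - 4) - 4 * c * w"
    unfolding a_def b_def c_def w_def n_def by (simp add: power2_eq_square algebra_simps)
  have "16 * m * w - ((a + b * X - c * (X^2 - Y^2))^2 + (b * Y - c * (2 * X * Y))^2)
       - n * w * ((1 + m - (m - 1) * X)^2 + ((m - 1) * Y)^2)
    = (16 * m * w - a^2 - n * w * (1+m)^2) + 2 * (- a * b + n*w*(m^2-1)) * X + (- (b^2) - n*w*(m-1)^2) * (X^2 + Y^2)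
      + 2 * a * c * (X^2 - Y^2) + 2 * b * c * X * (X^2+Y^2) - c^2 * (X^2+Y^2)^2"
    by algebra
  also have "\<dots> = a * c * d^2 + (1 - (X^2 + Y^2)) *
         (c * (a + c) * d + w * n * (8*m - 4) + 4 * c * w * (1 - X))"
    unfolding 1 2 3 unfolding b d_def by algebra
  finally show ?thesis .
qed

text \<open>Equality holds at \<open>g = 1\<close>, where \<open>K = 2 (5 m - 3)\<close> and
  \<open>M = 2\<close>. The ratio \<open>5 m - 3\<close> of these values dictates the weights that
  reduce the sum of norms to a sum of squares without loss at that point.\<close>

lemma mcs_split_bound:
  fixes m :: real and g :: complex
  assumes m: "1 \<le> m" "m \<le> 3" and g: "cmod g \<le> 1"
  shows "cmod (of_real (m * (m^2 - 1)) + of_real ((3 - m) * (2*m - 1) * (m + 1)) * g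
               - of_real ((3 - m) * (m - 1)^2) * g^2)
         + (3 - m) * cmod (of_real (1 + m) - of_real (m - 1) * g) \<le> 8 * m"
    (is "cmod ?K + _ * cmod ?M \<le> _")
proof -
  define X Y where "X = Re g" and "Y = Im g"
  define a b c d where "a = m * (m^2 - 1)" and "b = (3 - m) * (2*m - 1) * (m + 1)"
    and "c = (3 - m) * (m - 1)^2" and "d = (1 - X)^2 + Y^2"
  have XY: "X^2 + Y^2 \<le> 1"
    using power_mono[OF g, of 2] by (simp add: cmod_power2 X_def Y_def)
  have X1: "X \<le> 1" using complex_Re_le_cmod[of g] g by (simp add: X_def)
  \<comment> \<open>The sign of \<open>a\<close> uses \<open>1 \<le> m\<close>, which corresponds to
    \<open>\<theta> \<ge> 1/2\<close>.\<close>
  have a0: "a \<ge> 0" and c0: "c \<ge> 0" and d0: "d \<ge> 0"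
    using m by (simp_all add: a_def c_def d_def)
  have K: "(cmod ?K)^2 = (a + b * X - c * (X^2 - Y^2))^2 + (b * Y - c * (2 * X * Y))^2"
    unfolding cmod_power2 a_def b_def c_def X_def Y_def
    by (simp add: Re_power2 Im_power2 del: of_real_mult of_real_diff of_real_add of_real_power)
  have M: "(cmod ?M)^2 = (1 + m - (m - 1) * X)^2 + ((m - 1) * Y)^2"
    unfolding cmod_power2 X_def Y_def
    by (simp add: power2_eq_square del: of_real_mult of_real_diff of_real_add of_real_power)
  define k M where "k = cmod ?K" and "M = cmod ?M"
  define w where "w = (3 - m) * (5*m - 3)"
  have "16 * m * (5*m - 3) - k^2 - w * M^2 = a * c * d^2 + (1 - (X^2 + Y^2)) *
         (c * (a + c) * d + (5*m - 3) * (3 - m) * (8*m - 4) + 4 * c * (5*m - 3) * (1 - X))"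
    unfolding k_def M_def w_def K M a_def b_def c_def d_def by (rule mcs_split_real_identity)
  also have "\<dots> \<ge> 0"
    using m XY X1 a0 c0 d0 by (intro add_nonneg_nonneg mult_nonneg_nonneg) auto
  finally have E: "k^2 + w * M^2 \<le> 16 * m * (5*m - 3)" by simp
  \<comment> \<open>Cauchy--Schwarz with weights \<open>(5 m - 3) + (3 - m) = 4 m\<close>\<close>
  have "(5*m - 3) * (k + (3 - m) * M)^2
      = 4 * m * (k^2 + w * M^2) - (3 - m) * (k - (5*m - 3) * M)^2"
    unfolding w_def by algebra
  also have "\<dots> \<le> 4 * m * (k^2 + w * M^2)"
    using m by simp
  also have "\<dots> \<le> 4 * m * (16 * m * (5*m - 3))"
    using m E by (intro mult_left_mono) auto
  also have "\<dots> = (5*m - 3) * (8 * m)^2"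
    by algebra
  finally have "(k + (3 - m) * M)^2 \<le> (8 * m)^2"
    using m by (subst (asm) mult_le_cancel_left_pos) auto
  moreover have "0 \<le> 8 * m" using m by simp
  ultimately have "k + (3 - m) * M \<le> 8 * m" by (rule power2_le_imp_le)
  then show ?thesis by (simp only: k_def M_def)
qed

text \<open>The squared norms differ by \<open>4 m (1 - |g|^2)\<close>. For \<open>m > 0\<close> the
  quotient is the disc automorphism \<open>(q - g) / (1 - q g)\<close> with
  \<open>q = (m - 1) / (m + 1)\<close>.\<close>

lemma norm_affine_reflect_le:
  fixes m :: real and g :: complex
  assumes m: "0 \<le> m" and g: "cmod g \<le> 1"
  shows "cmod (of_real (m - 1) - of_real (m + 1) * g) \<le> cmod (of_real (1 + m) - of_real (m - 1) * g)"
proof (rule power2_le_imp_le)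
  have "(Re g)^2 + (Im g)^2 \<le> 1"
    using power_mono[OF g, of 2] by (simp add: cmod_power2)
  then have "0 \<le> 4 * m * (1 - ((Re g)^2 + (Im g)^2))"
    using m by simp
  also have "\<dots> = ((1 + m - (m - 1) * Re g)^2 + ((m - 1) * Im g)^2)
                 - ((m - 1 - (m + 1) * Re g)^2 + ((m + 1) * Im g)^2)"
    by algebra
  finally show "(cmod (of_real (m - 1) - of_real (m + 1) * g))^2
      \<le> (cmod (of_real (1 + m) - of_real (m - 1) * g))^2"
    unfolding cmod_power2
    by (simp add: power2_eq_square del: of_real_mult of_real_diff of_real_add of_real_power)
qed simp

lemma mcs_disc_bound:
  fixes \<kappa> :: real and \<beta> \<gamma> :: complex
  assumes \<kappa>: "0 \<le> \<kappa>" "\<kappa> \<le> 1" and \<beta>\<gamma>: "cmod \<beta> + cmod (\<gamma> - \<beta>) \<le> 1"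
  shows "cmod (1 + of_real \<kappa> * (3 - \<beta>) * (\<gamma> - 1) / 2 + of_real (\<kappa>^2) * (\<gamma> - 1)^2 / 2) \<le> 1"
    (is "cmod ?R \<le> 1")
proof -
  define m where "m = 3 - 2 * \<kappa>"
  have m: "1 \<le> m" "m \<le> 3" and \<kappa>m: "\<kappa> = (3 - m) / 2" using \<kappa> by (simp_all add: m_def)
  have g: "cmod \<gamma> \<le> 1"
    using norm_triangle_ineq[of \<beta> "\<gamma> - \<beta>"] \<beta>\<gamma> by simp
  define K where "K = of_real (m * (m^2 - 1)) + of_real ((3 - m) * (2*m - 1) * (m + 1)) * \<gamma>
               - of_real ((3 - m) * (m - 1)^2) * \<gamma>^2"
  define M where "M = of_real (1 + m) - of_real (m - 1) * \<gamma>"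
  define L where "L = of_real (m - 1) - of_real (m + 1) * \<gamma>"
  have LM: "cmod L \<le> cmod M"
    unfolding L_def M_def using m g by (intro norm_affine_reflect_le) auto
  \<comment> \<open>The coefficient of \<beta> forces \<open>M + L = 2 m (1 - \<gamma>)\<close>. The
    choice of \<open>L\<close> is otherwise free, since \<open>K\<close> absorbs
    \<open>(3 - m) L \<gamma>\<close>.\<close>
  have split: "complex_of_real (8 * m) * ?R = K + of_real (3 - m) * (M * \<beta> - L * (\<gamma> - \<beta>))"
    unfolding K_def M_def L_def m_def of_real_mult of_real_diff of_real_add of_real_power
      of_real_numeral of_real_1
    by (simp add: power2_eq_square field_simps)
  have "8 * m * cmod ?R = cmod (complex_of_real (8 * m) * ?R)"
    using m by (simp only: norm_mult norm_of_real)
  also have "\<dots> = cmod (K + of_real (3 - m) * (M * \<beta> - L * (\<gamma> - \<beta>)))"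
    by (simp only: split)
  also have "\<dots> \<le> cmod K + (3 - m) * cmod (M * \<beta> - L * (\<gamma> - \<beta>))"
    using m norm_triangle_ineq[of K "of_real (3 - m) * (M * \<beta> - L * (\<gamma> - \<beta>))"]
    unfolding norm_mult[of "of_real _"] norm_of_real by simp
  also have "\<dots> \<le> cmod K + (3 - m) * cmod M"
  proof (intro add_left_mono mult_left_mono)
    have "cmod (M * \<beta> - L * (\<gamma> - \<beta>)) \<le> cmod M * cmod \<beta> + cmod L * cmod (\<gamma> - \<beta>)"
      using norm_triangle_ineq4[of "M * \<beta>" "L * (\<gamma> - \<beta>)"] unfolding norm_mult .
    also have "\<dots> \<le> cmod M * cmod \<beta> + cmod M * cmod (\<gamma> - \<beta>)"
      using LM by (intro add_left_mono mult_right_mono) auto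
    also have "\<dots> = cmod M * (cmod \<beta> + cmod (\<gamma> - \<beta>))"
      by (simp add: distrib_left)
    also have "\<dots> \<le> cmod M"
      using \<beta>\<gamma> by (intro mult_left_le) auto
    finally show "cmod (M * \<beta> - L * (\<gamma> - \<beta>)) \<le> cmod M" .
  qed (use m in simp)
  also have "\<dots> \<le> 8 * m"
    unfolding K_def M_def using m g by (rule mcs_split_bound)
  finally show ?thesis using m by simp
qed

section \<open>Complex arguments\<close>

lemma stab_cond_bounds:
  assumes "stab_cond w0 z0 z1 z2"
  shows "Re z1 \<le> 0" "Re z2 \<le> 0" "cmod (w0 + z0) \<le> 2 * sqrt (Re z1 * Re z2)"
  using assms norm_triangle_ineq[of w0 z0] norm_ge_zero[of w0]
  unfolding stab_cond_def by linarith+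

text \<open>Writes \<open>|1 - t z|\<close> as the Euclidean length of a plane vector, so that
  Cauchy--Schwarz bounds a product of two such factors from below.\<close>

lemma cmod_one_minus_eq:
  "cmod (1 - of_real t * z) = sqrt ((cmod (1 + of_real t * z))\<^sup>2 + (2 * sqrt (t * - Re z))\<^sup>2)"
  if "t * Re z \<le> 0"
proof -
  have "(cmod (1 - of_real t * z))\<^sup>2 = (cmod (1 + of_real t * z))\<^sup>2 + 4 * (t * - Re z)"
    unfolding cmod_power2 by (simp add: power2_eq_square algebra_simps)
  then show ?thesis
    using that by (intro real_sqrt_unique[symmetric]) (auto simp: power_mult_distrib)
qed

lemma mcs_R_complex_bound:
  fixes \<theta> :: real and w0 z0 z1 z2 :: complex
  assumes \<theta>: "1 / 2 \<le> \<theta>" and st: "stab_cond w0 z0 z1 z2"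
  shows "cmod (mcs_R \<theta> w0 z0 z1 z2) \<le> 1"
proof -
  define u p where "u = w0 + z0" and "p = mcs_p \<theta> z1 z2"
  define \<beta> where "\<beta> = (1 + of_real \<theta> * z1) * (1 + of_real \<theta> * z2) / p"
  define \<gamma> where "\<gamma> = 1 + 2 * of_real \<theta> * (u + z1 + z2) / p"
  have x: "Re z1 \<le> 0" "Re z2 \<le> 0" and u: "cmod u \<le> 2 * sqrt (Re z1 * Re z2)"
    using stab_cond_bounds[OF st] by (simp_all add: u_def)
  have t: "\<theta> * Re z1 \<le> 0" "\<theta> * Re z2 \<le> 0"
    using \<theta> x by (simp_all add: mult_le_0_iff)
  have "Re (1 - of_real \<theta> * z1) \<noteq> 0" "Re (1 - of_real \<theta> * z2) \<noteq> 0"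
    using t by auto
  then have "1 - of_real \<theta> * z1 \<noteq> 0" "1 - of_real \<theta> * z2 \<noteq> 0"
    by (metis zero_complex.simps(1))+
  then have p0: "p \<noteq> 0"
    by (simp add: p_def mcs_p_def)
  have "cmod (\<beta> * p) + cmod ((\<gamma> - \<beta>) * p) \<le> cmod p"
  proof -
    \<comment> \<open>Since \<open>\<beta> = 1 + 2 \<theta> (z1 + z2) / p\<close>, the difference
      isolates the explicit part \<open>u\<close>.\<close>
    have "(\<gamma> - \<beta>) * p = 2 * of_real \<theta> * u"
    proof -
      have "\<gamma> * p = p + 2 * of_real \<theta> * (u + z1 + z2)"
        "\<beta> * p = (1 + of_real \<theta> * z1) * (1 + of_real \<theta> * z2)"
        using p0 by (simp_all add: \<beta>_def \<gamma>_def add_divide_eq_iff)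
      then show ?thesis
        by (simp add: left_diff_distrib) (simp add: p_def mcs_p_def algebra_simps)
    qed
    then have "cmod ((\<gamma> - \<beta>) * p) \<le> 2 * \<theta> * (2 * sqrt (Re z1 * Re z2))"
      using \<theta> u by (simp add: norm_mult)
    also have "\<dots> = (2 * sqrt (\<theta> * - Re z1)) * (2 * sqrt (\<theta> * - Re z2))"
      using \<theta> by (simp add: real_sqrt_mult[symmetric]) (simp add: real_sqrt_mult)
    finally have "cmod (\<beta> * p) + cmod ((\<gamma> - \<beta>) * p)
        \<le> cmod (1 + of_real \<theta> * z1) * cmod (1 + of_real \<theta> * z2)
          + (2 * sqrt (\<theta> * - Re z1)) * (2 * sqrt (\<theta> * - Re z2))"
      using p0 by (simp add: \<beta>_def norm_mult)
    also have "\<dots> \<le> cmod (1 - of_real \<theta> * z1) * cmod (1 - of_real \<theta> * z2)"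
      unfolding cmod_one_minus_eq[OF t(1)] cmod_one_minus_eq[OF t(2)] real_sqrt_mult[symmetric]
    proof (rule real_le_rsqrt)
      \<comment> \<open>Lagrange's identity in the plane; the fixed variables are generalized and
        then matched with the norms and square roots of the goal.\<close>
      fix n1 n2 s1 s2 :: real
      have "0 \<le> (n1 * s2 - n2 * s1)\<^sup>2" by simp
      then show "(n1 * n2 + s1 * s2)\<^sup>2 \<le> (n1\<^sup>2 + s1\<^sup>2) * (n2\<^sup>2 + s2\<^sup>2)"
        by (simp add: power2_eq_square algebra_simps)
    qed
    finally show ?thesis by (simp add: p_def mcs_p_def norm_mult)
  qed
  then have "(cmod \<beta> + cmod (\<gamma> - \<beta>)) * cmod p \<le> 1 * cmod p"
    by (simp add: norm_mult distrib_right)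
  then have \<beta>\<gamma>: "cmod \<beta> + cmod (\<gamma> - \<beta>) \<le> 1"
    using p0 by (subst (asm) mult_le_cancel_right_pos) auto
  define \<kappa> where "\<kappa> = 1 / (2 * \<theta>)"
  have "mcs_R \<theta> w0 z0 z1 z2 =
      1 + of_real \<kappa> * (3 - \<beta>) * (\<gamma> - 1) / 2 + of_real (\<kappa>^2) * (\<gamma> - 1)^2 / 2"
  proof -
    define y where "y = (u + z1 + z2) / p"
    have y: "of_real \<kappa> * (\<gamma> - 1) = y"
      using \<theta> by (simp add: \<kappa>_def \<gamma>_def y_def)
    have b: "(3 - \<beta>) / 2 = 1 - of_real \<theta> * (z1 + z2) / p"
      using p0 by (simp add: \<beta>_def field_simps) (simp add: p_def mcs_p_def algebra_simps)
    have "mcs_R \<theta> w0 z0 z1 z2 = 1 + y + of_real \<theta> * (u / p) * y + (1/2 - of_real \<theta>) * y\<^sup>2"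
      by (simp add: mcs_R_def Let_def y_def u_def p_def power2_eq_square)
    also have "u / p = y - (z1 + z2) / p"
      by (simp add: y_def add_divide_distrib)
    also have "1 + y + of_real \<theta> * (y - (z1 + z2) / p) * y + (1/2 - of_real \<theta>) * y\<^sup>2
        = 1 + ((3 - \<beta>) / 2) * y + y\<^sup>2 / 2"
      unfolding b by (simp add: power2_eq_square algebra_simps)
    finally show ?thesis
      unfolding y[symmetric] of_real_power power_mult_distrib by (simp add: mult_ac)
  qed
  then show ?thesis
    using mcs_disc_bound[OF _ _ \<beta>\<gamma>, of \<kappa>] \<theta> by (simp add: \<kappa>_def)
qed

section \<open>Real arguments\<close>

lemma mcs_R_real_bound:
  fixes \<theta> w0 z0 z1 z2 :: real
  assumes \<theta>: "1 / 3 \<le> \<theta>" and st: "stab_cond (of_real w0) (of_real z0) (of_real z1) (of_real z2)"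
  shows "cmod (mcs_R \<theta> (of_real w0) (of_real z0) (of_real z1) (of_real z2)) \<le> 1"
proof -
  define u s y where "u = w0 + z0" and "s = - (z1 + z2)" and "y = sqrt (z1 * z2)"
  define z p where "z = u - s" and "p = (1 - \<theta> * z1) * (1 - \<theta> * z2)"
  define r where "r = 1 + z / p + \<theta> * (u * z / p\<^sup>2) + (1 / 2 - \<theta>) * (z\<^sup>2 / p\<^sup>2)"
  have x: "z1 \<le> 0" "z2 \<le> 0" and u: "\<bar>u\<bar> \<le> 2 * y"
    using stab_cond_bounds[OF st] unfolding of_real_add[symmetric] norm_of_real
    by (simp_all add: u_def y_def)
  have y0: "y \<ge> 0" and y2: "y\<^sup>2 = z1 * z2"
    using x by (simp_all add: y_def mult_nonpos_nonpos)
  have s: "2 * y \<le> s"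
  proof (rule power2_le_imp_le)
    have "s\<^sup>2 - (2 * y)\<^sup>2 = (z1 - z2)\<^sup>2"
      unfolding power_mult_distrib y2 by (simp add: s_def power2_eq_square algebra_simps)
    then show "(2 * y)\<^sup>2 \<le> s\<^sup>2" by (metis diff_ge_0_iff_ge zero_le_power2)
    show "0 \<le> s" using x by (simp add: s_def)
  qed
  have p: "p = 1 + \<theta> * s + \<theta>\<^sup>2 * y\<^sup>2"
    unfolding y2 by (simp add: p_def s_def power2_eq_square algebra_simps)
  have \<theta>s: "0 \<le> \<theta> * s" using \<theta> s y0 by simp
  have ps: "\<theta> * s < p" and p0: "0 < p"
    using \<theta>s unfolding p by (auto simp: add_pos_nonneg)
  have z0: "z \<le> 0" using u s by (simp add: z_def)
  have quad: "0 \<le> 1 + (4 * \<theta> - 2) * y + \<theta>\<^sup>2 * y\<^sup>2"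
  proof -
    have "1 + (4 * \<theta> - 2) * y + \<theta>\<^sup>2 * y\<^sup>2 = (1 - \<theta> * y)\<^sup>2 + 2 * (3 * \<theta> - 1) * y"
      by (simp add: power2_eq_square algebra_simps)
    then show ?thesis using \<theta> y0 by simp
  qed
  \<comment> \<open>This is the cofactor of \<open>z\<close> in \<open>p^2 (r - 1)\<close>. In terms
    of \<open>s\<close> and \<open>u\<close> it increases in both, so the worst case is
    \<open>s = 2 y\<close>, \<open>u = - 2 y\<close>, which gives the quadratic of
    \<open>quad\<close>.\<close>
  have "0 \<le> p + \<theta> * u + (1 / 2 - \<theta>) * z"
  proof -
    have "(2 * \<theta> - 1 / 2) * (2 * y) \<le> (2 * \<theta> - 1 / 2) * s"
      using \<theta> s by (intro mult_left_mono) auto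
    moreover have "p + \<theta> * u + (1 / 2 - \<theta>) * z = 1 + (2 * \<theta> - 1 / 2) * s + \<theta>\<^sup>2 * y\<^sup>2 + u / 2"
      by (simp add: p z_def field_simps)
    ultimately show ?thesis using quad u by (simp add: algebra_simps)
  qed
  then have "z * (p + \<theta> * u + (1 / 2 - \<theta>) * z) / p\<^sup>2 \<le> 0"
    using z0 by (intro divide_nonpos_nonneg mult_nonpos_nonneg) auto
  moreover have "r - 1 = z * (p + \<theta> * u + (1 / 2 - \<theta>) * z) / p\<^sup>2"
    using p0 by (simp add: r_def field_simps power2_eq_square)
  ultimately have "r \<le> 1" by simp
  moreover have "- 1 \<le> r"
  proof -
    have "(p + \<theta> * s)\<^sup>2 \<le> (2 * p)\<^sup>2"
      using ps \<theta>s p0 by (intro power_mono) auto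
    then have "0 \<le> (z + (p + \<theta> * s))\<^sup>2 / 2 + ((2 * p)\<^sup>2 - (p + \<theta> * s)\<^sup>2) / 2"
      by simp
    also have "\<dots> = 2 * p\<^sup>2 + (p + \<theta> * s) * z + z\<^sup>2 / 2"
      by (simp add: power2_eq_square field_simps)
    \<comment> \<open>Substituting \<open>u = z + s\<close> cancels the two terms
      \<open>\<theta> z^2\<close> and leaves \<open>z^2 / 2\<close>.\<close>
    also have "\<dots> = (r + 1) * p\<^sup>2"
    proof -
      have "(r + 1) * p\<^sup>2 = 2 * p\<^sup>2 + z * p + \<theta> * (u * z) + (1 / 2 - \<theta>) * z\<^sup>2"
        using p0 by (simp add: r_def field_simps power2_eq_square)
      then show ?thesis by (simp add: z_def power2_eq_square field_simps)
    qed
    finally show ?thesis using p0 by (simp add: zero_le_mult_iff)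
  qed
  moreover have "mcs_R \<theta> (of_real w0) (of_real z0) (of_real z1) (of_real z2) = of_real r"
  proof -
    have "z = w0 + z0 + z1 + z2" by (simp add: z_def u_def s_def)
    then show ?thesis by (simp add: mcs_R_def mcs_p_def Let_def r_def p_def u_def)
  qed
  ultimately show ?thesis by (simp add: abs_le_iff)
qed

theorem theorem2:
  fixes \<theta> :: real
  assumes "\<theta> > 0"
  shows "(\<theta> \<ge> 1 / 3 \<longrightarrow>
           (\<forall>w0 z0 z1 z2 :: real.
              stab_cond (of_real w0) (of_real z0) (of_real z1) (of_real z2) \<longrightarrow>
              cmod (mcs_R \<theta> (of_real w0) (of_real z0) (of_real z1) (of_real z2)) \<le> 1)) \<and>
         (1 / 2 \<le> \<theta> \<and> \<theta> \<le> 1 \<longrightarrow>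
           (\<forall>w0 z0 z1 z2 :: complex.
              stab_cond w0 z0 z1 z2 \<longrightarrow> cmod (mcs_R \<theta> w0 z0 z1 z2) \<le> 1))"
  using mcs_R_real_bound mcs_R_complex_bound by blast

end
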